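(* Let $x$ and $y$ be representations of a countable set $A$ with $\mathrm{comp}(x)\subseteq\mathrm{comp}(y)$. If $x(A)$ is computationally enumerable, then so is $y(A)$.
   Context: $\mathbb{T}$ denotes the set of tapes over a fixed finite alphabet with finitely many non-blank symbols. For $Q\subseteq\mathbb{T}$, a function with domain $Q$ and values in $\mathbb{T}$ is computable if some Turing machine, on every input $\tau\in Q$, halts with output equal to the function's value (nothing is required outside $Q$). A set $Q\subseteq\mathbb{T}$ is computationally enumerable (c.e.) if there is a computable function $h$ with domain $Q$ and values in $Q$ and a tape $\tau_0\in Q$ such that each $\tau\in Q$ equals $h^i(\tau_0)$ for some $i\in\mathbb{N}$ (equivalently, some Turing machine halts exactly on the tapes of $Q$). A representation of $A$ is an injective function $A\to\mathbb{T}$; for a representation $x$, $\mathrm{comp}(x)$ is the set of functions $g$ with domain $A$ and values in $A$ such that $x\circ g\circ x^{-1}$ (defined on $x(A)$) is computable. *)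

theory Defs
  imports Main "HOL-Library.FuncSet" "HOL-Library.Countable_Set"
begin

(* The alphabet is 'c option with None as the blank, so 'c holds the (at least one, finitely many)
   non-blank symbols. Cells are indexed relative to the head: cell 0 is always the scanned cell. *)
typedef ('c::finite) tape = "{t :: int \<Rightarrow> 'c option. finite {i. t i \<noteq> None}}"
  by (rule exI[of _ "\<lambda>_. None"]) simp

setup_lifting type_definition_tape

datatype dir = Left | Stay | Right

fun offset :: "dir \<Rightarrow> int" where
  "offset Left = -1"
| "offset Stay = 0"
| "offset Right = 1"

lift_definition scanned :: "'c::finite tape \<Rightarrow> 'c option" is "\<lambda>t. t 0" .

lift_definition write_cell :: "'c option \<Rightarrow> 'c::finite tape \<Rightarrow> 'c tape" is "\<lambda>s t. t(0 := s)"
proof -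
  fix s :: "'c option" and t :: "int \<Rightarrow> 'c option"
  assume "finite {i. t i \<noteq> None}"
  then show "finite {i. (t(0 := s)) i \<noteq> None}"
    by (rule rev_finite_subset[OF finite.insertI[of _ 0]]) auto
qed

lift_definition move_head :: "dir \<Rightarrow> 'c::finite tape \<Rightarrow> 'c tape" is "\<lambda>d t i. t (i + offset d)"
proof -
  fix d and t :: "int \<Rightarrow> 'c option"
  assume "finite {i. t i \<noteq> None}"
  then have "finite ((\<lambda>i. i + offset d) -` {i. t i \<noteq> None})"
    by (rule finite_vimageI) (simp add: inj_def)
  then show "finite {i. t (i + offset d) \<noteq> None}"
    by (simp add: vimage_def)
qed

(* The transition table of a deterministic machine with states in nat and initial state 0.
   It is a Turing machine when the table is finite; it halts where the table has no entry. *)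
type_synonym 'c machine = "nat \<times> 'c option \<rightharpoonup> nat \<times> 'c option \<times> dir"

inductive halts_with :: "'c::finite machine \<Rightarrow> nat \<Rightarrow> 'c tape \<Rightarrow> 'c tape \<Rightarrow> bool"
  for M :: "'c::finite machine" where
  halt: "M (q, scanned t) = None \<Longrightarrow> halts_with M q t t"
| step: "M (q, scanned t) = Some (q', s, d) \<Longrightarrow>
         halts_with M q' (move_head d (write_cell s t)) u \<Longrightarrow> halts_with M q t u"

definition computable_on :: "'c::finite tape set \<Rightarrow> ('c tape \<Rightarrow> 'c tape) \<Rightarrow> bool" where
  "computable_on Q f \<longleftrightarrow>
     (\<exists>M :: 'c machine. finite (dom M) \<and> (\<forall>\<tau>\<in>Q. halts_with M 0 \<tau> (f \<tau>)))"

definition comp_enumerable :: "'c::finite tape set \<Rightarrow> bool" where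
  "comp_enumerable Q \<longleftrightarrow>
     (\<exists>h \<tau>\<^sub>0. h \<in> Q \<rightarrow> Q \<and> computable_on Q h \<and> \<tau>\<^sub>0 \<in> Q \<and> (\<forall>\<tau>\<in>Q. \<exists>i::nat. \<tau> = (h ^^ i) \<tau>\<^sub>0))"

definition representation :: "'a set \<Rightarrow> ('a \<Rightarrow> 'c::finite tape) \<Rightarrow> bool" where
  "representation A x \<longleftrightarrow> inj_on x A"

(* Functions with domain A are taken extensional (undefined outside A), so that the members of
   comp_functions A x are exactly the partial functions with domain A. *)
definition comp_functions :: "'a set \<Rightarrow> ('a \<Rightarrow> 'c::finite tape) \<Rightarrow> ('a \<Rightarrow> 'a) set" where
  "comp_functions A x = {g \<in> A \<rightarrow>\<^sub>E A. computable_on (x ` A) (x \<circ> g \<circ> inv_into A x)}"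

end

theory Submission
  imports Defs
begin

(* Transporting the enumerating function h of x(A) to A gives g in comp(x), hence in comp(y);
   every element of A lies on the g-orbit of a single point, so y g y^-1 enumerates y(A). *)

text \<open>That A is the forward orbit of one point under g is a statement about g alone,
  independent of how A is represented. Only the computability of g depends on the representation,
  and the inclusion of comp(x) in comp(y) carries it over. \<open>funpow_semiconj_on\<close> moves
  orbits between A and its images under x and y.\<close>

lemma computable_on_cong:
  assumes "\<And>\<tau>. \<tau> \<in> Q \<Longrightarrow> f \<tau> = f' \<tau>"
  shows "computable_on Q f \<longleftrightarrow> computable_on Q f'"
  using assms by (simp add: computable_on_def)

text \<open>The intertwining holds only on A, so the induction must also carry that the orbit stays
  in A.\<close>

lemma funpow_semiconj_on:
  assumes "g \<in> A \<rightarrow> A" and "\<And>a. a \<in> A \<Longrightarrow> h (x a) = x (g a)" and "a \<in> A"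
  shows "(h ^^ i) (x a) = x ((g ^^ i) a) \<and> (g ^^ i) a \<in> A"
  using assms by (induction i) auto

theorem theorem9:
  fixes A :: "'a set" and x y :: "'a \<Rightarrow> 'c::finite tape"
  assumes "countable A"
    and "representation A x" and "representation A y"
    and "comp_functions A x \<subseteq> comp_functions A y"
    and "comp_enumerable (x ` A)"
  shows "comp_enumerable (y ` A)"
proof -
  have injx: "inj_on x A" and injy: "inj_on y A"
    using assms(2,3) by (auto simp: representation_def)
  obtain h a\<^sub>0 where h: "h \<in> x ` A \<rightarrow> x ` A" "computable_on (x ` A) h" and a\<^sub>0: "a\<^sub>0 \<in> A"
    and orbit: "\<And>a. a \<in> A \<Longrightarrow> \<exists>i. x a = (h ^^ i) (x a\<^sub>0)"
    using assms(5) unfolding comp_enumerable_def by fast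
  \<comment> \<open>The restriction makes g extensional, as membership in
    \<open>comp_functions\<close> demands.\<close>
  define g where "g = restrict (inv_into A x \<circ> h \<circ> x) A"
  have gA: "g \<in> A \<rightarrow>\<^sub>E A"
    using h(1) by (simp add: g_def Pi_iff inv_into_into)
  then have gA': "g \<in> A \<rightarrow> A" by auto
  have xg: "h (x a) = x (g a)" if "a \<in> A" for a
    using that h(1) by (auto simp: g_def f_inv_into_f Pi_iff)
  have "computable_on (x ` A) (x \<circ> g \<circ> inv_into A x)"
    \<comment> \<open>Conjugating g back by x gives h on the image of A; elsewhere the two may
      differ.\<close>
    using h(2) by (rule computable_on_cong[THEN iffD1, rotated]) (auto simp: injx xg)
  then have "g \<in> comp_functions A y"
    using gA assms(4) by (auto simp: comp_functions_def)
  moreover define k where "k = y \<circ> g \<circ> inv_into A y"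
  ultimately have "computable_on (y ` A) k"
    by (simp add: comp_functions_def)
  moreover have yg: "k (y a) = y (g a)" if "a \<in> A" for a
    using that injy by (simp add: k_def)
  then have "k \<in> y ` A \<rightarrow> y ` A"
    using gA' by auto
  moreover have "\<exists>i. y a = (k ^^ i) (y a\<^sub>0)" if a: "a \<in> A" for a
  proof -
    obtain i where "x a = (h ^^ i) (x a\<^sub>0)"
      using orbit[OF a] by blast
    \<comment> \<open>Injectivity of x pulls the orbit back to A, since the iterate of g lies in A;
      y then pushes it forward.\<close>
    then have "a = (g ^^ i) a\<^sub>0"
      using funpow_semiconj_on[of g A h x, OF gA' xg a\<^sub>0] inj_onD[OF injx _ a] by auto
    then show ?thesis
      using funpow_semiconj_on[of g A k y, OF gA' yg a\<^sub>0] by auto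
  qed
  ultimately show ?thesis
    unfolding comp_enumerable_def using a\<^sub>0 by blast
qed

end
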